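(* Let $c_1,c_2,c_3>0$ and let $Z\in\left(-\sum_{j=1}^3 c_j,\,0\right)$. Let $\Phi_Z=(\phi_1,\phi_2,\phi_3,0,0,0)$ be the stationary kink profile $$\phi_1(x)=4\arctan\left(e^{(x-a_1)/c_1}\right)\ (x<0),\qquad \phi_i(x)=4\arctan\left(e^{-(x-a_i)/c_i}\right)\ (x>0,\ i=2,3),$$ where $a_1=a_1(Z)\in\mathbb R$ is determined by $$-\frac{e^{-a_1/c_1}}{1+e^{-2a_1/c_1}}\sum_{j=1}^3 c_j = Z\arctan\left(e^{-a_1/c_1}\right)$$ and $a_2,a_3$ are determined by $\frac{a_1}{c_1}=-\frac{a_2}{c_2}=-\frac{a_3}{c_3}$. Then $\Phi_Z$ is spectrally unstable for the sine-Gordon model on the $\mathcal Y$-junction with $\delta$-interaction of intensity $Z$ at the vertex.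
   Context: $\mathcal Y$ is the metric graph with edges $E_1=(-\infty,0)$, $E_2=E_3=(0,\infty)$ joined at the vertex $\nu=0$. $L^2(\mathcal Y)=L^2(-\infty,0)\oplus L^2(0,\infty)\oplus L^2(0,\infty)$ and $H^m(\mathcal Y)=H^m(-\infty,0)\oplus H^m(0,\infty)\oplus H^m(0,\infty)$, with the natural norms. The energy space is $\mathcal E(\mathcal Y)=\{(v_j)_{j=1}^3\in H^1(\mathcal Y): v_1(0-)=v_2(0+)=v_3(0+)\}$. The sine-Gordon model is $\partial_t u_j=v_j$, $\partial_t v_j=c_j^2\partial_x^2u_j-\sin u_j$ on $E_j$, $j=1,2,3$, with vertex conditions $u_1(0-)=u_2(0+)=u_3(0+)$ and $\sum_{j=2}^3c_j^2\partial_xu_j(0+)-c_1^2\partial_xu_1(0-)=Zu_1(0-)$. The profiles $\Phi_Z$ are stationary solutions: $-c_j^2\phi_j''+\sin\phi_j=0$ on $E_j$, and $(\phi_j)_{j=1}^3$ satisfies the vertex conditions. The linearized operator is $\mathcal L_Z\mathbf v=\left(-c_j^2v_j''+\cos(\phi_j)v_j\right)_{j=1}^3$ with domain $$D(\mathcal L_Z)=\Big\{\mathbf v\in H^2(\mathcal Y): v_1(0-)=v_2(0+)=v_3(0+),\ \sum_{j=2}^3c_j^2v_j'(0+)-c_1^2v_1'(0-)=Zv_1(0-)\Big\}.$$ The linearization of the first-order system around $\Phi_Z$ is $\mathbf w_t=J\mathcal E\,\mathbf w$ with $J\mathcal E(\mathbf u,\mathbf v)=(\mathbf v,-\mathcal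 L_Z\mathbf u)$, where $J=\begin{pmatrix}0&I_3\\-I_3&0\end{pmatrix}$ and $\mathcal E=\begin{pmatrix}\mathcal L_Z&0\\0&I_3\end{pmatrix}$. It is considered in $\mathcal E(\mathcal Y)\times L^2(\mathcal Y)$ with domain $D(\mathcal L_Z)\times\mathcal E(\mathcal Y)$. The stationary solution is called spectrally stable if $\sigma(J\mathcal E)\subset i\mathbb R$, and spectrally unstable otherwise. *)

theory Defs
  imports "HOL-Analysis.Analysis"
begin

datatype edge = E1 | E2 | E3

lemma UNIV_edge: "UNIV = {E1, E2, E3}"
  by (auto intro: edge.exhaust)

instance edge :: finite
  by standard (simp add: UNIV_edge)

fun edge_dom :: "edge \<Rightarrow> real set" where
  "edge_dom E1 = {..<0}"
| "edge_dom E2 = {0<..}"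
| "edge_dom E3 = {0<..}"

text \<open>
  Elements of Lebesgue and Sobolev spaces are represented by functions; two functions that agree
  almost everywhere on the interval represent the same element, and values outside the interval
  are irrelevant. All spaces are complex, as needed for the spectrum.
\<close>

definition L2 :: "real set \<Rightarrow> (real \<Rightarrow> complex) set" where
  "L2 I = {f. f \<in> borel_measurable (lebesgue_on I) \<and>
              integrable (lebesgue_on I) (\<lambda>x. (cmod (f x))\<^sup>2)}"

definition test_functions :: "real set \<Rightarrow> (real \<Rightarrow> real) set" where
  "test_functions I = {\<phi>. (\<forall>x. \<phi> differentiable at x) \<and> continuous_on UNIV (deriv \<phi>) \<and>
                          (\<exists>K. compact K \<and> K \<subseteq> I \<and> (\<forall>x. x \<notin> K \<longrightarrow> \<phi> x = 0))}"

text \<open>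
  Weak derivatives on an open interval are tested, as in Brezis, against continuously
  differentiable functions with compact support in the interval; infinitely differentiable test
  functions give the same notion.
\<close>

definition is_weak_deriv :: "real set \<Rightarrow> (real \<Rightarrow> complex) \<Rightarrow> (real \<Rightarrow> complex) \<Rightarrow> bool" where
  "is_weak_deriv I u g \<longleftrightarrow>
     (\<forall>\<phi>\<in>test_functions I.
        (\<integral>x. deriv \<phi> x *\<^sub>R u x \<partial>lebesgue_on I) = - (\<integral>x. \<phi> x *\<^sub>R g x \<partial>lebesgue_on I))"

primrec sobolev :: "real set \<Rightarrow> nat \<Rightarrow> (real \<Rightarrow> complex) set" where
  "sobolev I 0 = L2 I"
| "sobolev I (Suc m) = {u \<in> L2 I. \<exists>g\<in>sobolev I m. is_weak_deriv I u g}"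

text \<open>For \<open>u \<in> sobolev I 1\<close> the choice below is unique up to null sets.\<close>

definition weak_deriv :: "real set \<Rightarrow> (real \<Rightarrow> complex) \<Rightarrow> real \<Rightarrow> complex" where
  "weak_deriv I u = (SOME g. g \<in> L2 I \<and> is_weak_deriv I u g)"

text \<open>
  The one-sided limit at the vertex \<open>0\<close>, taken along the edge, of the continuous representative
  of \<open>u\<close> (which exists and has a limit if \<open>u\<close> is in the first-order Sobolev space of the edge).
\<close>

definition vertex_value :: "edge \<Rightarrow> (real \<Rightarrow> complex) \<Rightarrow> complex" where
  "vertex_value j u =
     (THE z. \<exists>w. continuous_on (edge_dom j) w \<and> (AE x in lebesgue_on (edge_dom j). u x = w x) \<and>
                 (w \<longlongrightarrow> z) (at 0 within edge_dom j))"

type_synonym graph_fun = "edge \<Rightarrow> real \<Rightarrow> complex"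

definition deriv_Y :: "graph_fun \<Rightarrow> graph_fun" where
  "deriv_Y u = (\<lambda>j. weak_deriv (edge_dom j) (u j))"

definition L2_Y :: "graph_fun set" where
  "L2_Y = {u. \<forall>j. u j \<in> L2 (edge_dom j)}"

definition H_Y :: "nat \<Rightarrow> graph_fun set" where
  "H_Y m = {u. \<forall>j. u j \<in> sobolev (edge_dom j) m}"

definition continuous_at_vertex :: "graph_fun \<Rightarrow> bool" where
  "continuous_at_vertex u \<longleftrightarrow>
     vertex_value E1 (u E1) = vertex_value E2 (u E2) \<and>
     vertex_value E2 (u E2) = vertex_value E3 (u E3)"

definition energy_space :: "graph_fun set" where
  "energy_space = {u \<in> H_Y 1. continuous_at_vertex u}"

definition norm_L2_Y :: "graph_fun \<Rightarrow> real" where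
  "norm_L2_Y u = sqrt (\<Sum>j\<in>UNIV. \<integral>x. (cmod (u j x))\<^sup>2 \<partial>lebesgue_on (edge_dom j))"

definition norm_H1_Y :: "graph_fun \<Rightarrow> real" where
  "norm_H1_Y u = sqrt ((norm_L2_Y u)\<^sup>2 + (norm_L2_Y (deriv_Y u))\<^sup>2)"

definition eq_ae_Y :: "graph_fun \<Rightarrow> graph_fun \<Rightarrow> bool" where
  "eq_ae_Y u v \<longleftrightarrow> (\<forall>j. AE x in lebesgue_on (edge_dom j). u j x = v j x)"

definition dom_L :: "(edge \<Rightarrow> real) \<Rightarrow> real \<Rightarrow> graph_fun set" where
  "dom_L c Z =
     {v \<in> H_Y 2. continuous_at_vertex v \<and>
        (\<Sum>j\<in>{E2, E3}. of_real ((c j)\<^sup>2) * vertex_value j (deriv_Y v j))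
          - of_real ((c E1)\<^sup>2) * vertex_value E1 (deriv_Y v E1)
        = of_real Z * vertex_value E1 (v E1)}"

definition L_op :: "(edge \<Rightarrow> real) \<Rightarrow> (edge \<Rightarrow> real \<Rightarrow> real) \<Rightarrow> graph_fun \<Rightarrow> graph_fun" where
  "L_op c \<phi> v = (\<lambda>j x. - of_real ((c j)\<^sup>2) * deriv_Y (deriv_Y v) j x + of_real (cos (\<phi> j x)) * v j x)"

text \<open>
  The linearization, around the stationary state with profile \<open>\<phi>\<close> and zero velocity, of the
  first-order sine-Gordon system. The intensity \<open>Z\<close> enters only through the domain.
\<close>

definition JE :: "(edge \<Rightarrow> real) \<Rightarrow> (edge \<Rightarrow> real \<Rightarrow> real) \<Rightarrow>
    graph_fun \<times> graph_fun \<Rightarrow> graph_fun \<times> graph_fun" where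
  "JE c \<phi> = (\<lambda>(u, v). (v, \<lambda>j x. - L_op c \<phi> u j x))"

definition dom_JE :: "(edge \<Rightarrow> real) \<Rightarrow> real \<Rightarrow> (graph_fun \<times> graph_fun) set" where
  "dom_JE c Z = dom_L c Z \<times> energy_space"

definition phase_space :: "(graph_fun \<times> graph_fun) set" where
  "phase_space = energy_space \<times> L2_Y"

definition phase_norm :: "graph_fun \<times> graph_fun \<Rightarrow> real" where
  "phase_norm = (\<lambda>(u, v). sqrt ((norm_H1_Y u)\<^sup>2 + (norm_L2_Y v)\<^sup>2))"

definition phase_eq :: "graph_fun \<times> graph_fun \<Rightarrow> graph_fun \<times> graph_fun \<Rightarrow> bool" where
  "phase_eq w w' \<longleftrightarrow> eq_ae_Y (fst w) (fst w') \<and> eq_ae_Y (snd w) (snd w')"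

definition JE_minus :: "(edge \<Rightarrow> real) \<Rightarrow> (edge \<Rightarrow> real \<Rightarrow> real) \<Rightarrow> complex \<Rightarrow>
    graph_fun \<times> graph_fun \<Rightarrow> graph_fun \<times> graph_fun" where
  "JE_minus c \<phi> \<mu> w =
     (\<lambda>j x. fst (JE c \<phi> w) j x - \<mu> * fst w j x, \<lambda>j x. snd (JE c \<phi> w) j x - \<mu> * snd w j x)"

text \<open>
  A point is in the resolvent set iff the shifted operator is injective and surjective (modulo
  almost-everywhere equality) from its domain onto the phase space, with bounded inverse.
\<close>

definition resolvent_JE :: "(edge \<Rightarrow> real) \<Rightarrow> real \<Rightarrow> (edge \<Rightarrow> real \<Rightarrow> real) \<Rightarrow> complex set" where
  "resolvent_JE c Z \<phi> =
     {\<mu>. (\<forall>w\<in>dom_JE c Z. \<forall>w'\<in>dom_JE c Z.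
            phase_eq (JE_minus c \<phi> \<mu> w) (JE_minus c \<phi> \<mu> w') \<longrightarrow> phase_eq w w') \<and>
         (\<forall>f\<in>phase_space. \<exists>w\<in>dom_JE c Z. phase_eq (JE_minus c \<phi> \<mu> w) f) \<and>
         (\<exists>C. \<forall>w\<in>dom_JE c Z. phase_norm w \<le> C * phase_norm (JE_minus c \<phi> \<mu> w))}"

definition spectrum_JE :: "(edge \<Rightarrow> real) \<Rightarrow> real \<Rightarrow> (edge \<Rightarrow> real \<Rightarrow> real) \<Rightarrow> complex set" where
  "spectrum_JE c Z \<phi> = - resolvent_JE c Z \<phi>"

definition spectrally_stable :: "(edge \<Rightarrow> real) \<Rightarrow> real \<Rightarrow> (edge \<Rightarrow> real \<Rightarrow> real) \<Rightarrow> bool" where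
  "spectrally_stable c Z \<phi> \<longleftrightarrow> spectrum_JE c Z \<phi> \<subseteq> {\<mu>. Re \<mu> = 0}"

definition spectrally_unstable :: "(edge \<Rightarrow> real) \<Rightarrow> real \<Rightarrow> (edge \<Rightarrow> real \<Rightarrow> real) \<Rightarrow> bool" where
  "spectrally_unstable c Z \<phi> \<longleftrightarrow> \<not> spectrally_stable c Z \<phi>"

fun kink :: "(edge \<Rightarrow> real) \<Rightarrow> (edge \<Rightarrow> real) \<Rightarrow> edge \<Rightarrow> real \<Rightarrow> real" where
  "kink c a E1 x = 4 * arctan (exp ((x - a E1) / c E1))"
| "kink c a E2 x = 4 * arctan (exp (- (x - a E2) / c E2))"
| "kink c a E3 x = 4 * arctan (exp (- (x - a E3) / c E3))"

end

theory Submission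
  imports Defs
begin

text \<open>
  The instability is caused by an explicit positive eigenvalue. After rescaling each edge to the
  half-line \<open>y < 0\<close>, the linearized potential is \<open>1 - 2 sech\<^sup>2 (y - b)\<close> on all edges, and the
  decaying solution of \<open>-v'' + (1 - 2 sech\<^sup>2 (y - b)) v = (1 - k\<^sup>2) v\<close> is
  \<open>exp (k y) * (k - tanh (y - b))\<close>. Taking it on every edge, the vertex condition reduces to
  \<open>S (k (k - t) - (1 - t\<^sup>2)) + Z (k - t) = 0\<close> with \<open>S = c\<^sub>1 + c\<^sub>2 + c\<^sub>3\<close> and \<open>t = tanh (- b)\<close>.
  At \<open>k = 1\<close> the left-hand side is \<open>(1 - t) (Z - S t)\<close>, which is negative because the equation for
  \<open>a\<^sub>1\<close> gives \<open>Z < S t\<close> (this is \<open>(1 - s\<^sup>2) arctan s < s\<close> for \<open>s = exp (- b)\<close>); at \<open>k = 3\<close> it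
  is positive. A root \<open>k > 1\<close> yields the eigenvalue \<open>sqrt (k\<^sup>2 - 1) > 0\<close>.
\<close>

section \<open>Weak derivatives and vertex values\<close>

lemma sigma_finite_lebesgue: "sigma_finite_measure (lebesgue :: 'a::euclidean_space measure)"
proof
  obtain A :: "'a set set" where A: "countable A" "A \<subseteq> sets lborel" "\<Union>A = space lborel"
      "\<forall>a\<in>A. emeasure lborel a \<noteq> \<infinity>"
    using lborel.sigma_finite_countable by metis
  have "A \<subseteq> sets (lebesgue :: 'a measure)" using A(2) by auto
  moreover have "\<forall>a\<in>A. emeasure lebesgue a \<noteq> \<infinity>" using A(2,4) by auto
  ultimately show "\<exists>A::'a set set. countable A \<and> A \<subseteq> sets lebesgue \<and> \<Union>A = space lebesgue \<and> (\<forall>a\<in>A. emeasure lebesgue a \<noteq> \<infinity>)"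
    using A by (intro exI[of _ A]) auto
qed

text \<open>Closed intervals generate the Borel sets, so the vanishing of integrals spreads to Borel
  sets by induction and to Lebesgue sets by discarding a null set. A function whose integral over
  every measurable set is zero vanishes almost everywhere.\<close>

lemma AE_zero_if_interval_integrals_zero:
  fixes h :: "real \<Rightarrow> 'b::{second_countable_topology, banach}"
  assumes int: "integrable lebesgue h"
    and zero: "\<And>a b. a \<le> b \<Longrightarrow> (\<integral>x. indicator {a..b} x *\<^sub>R h x \<partial>lebesgue) = 0"
  shows "AE x in lebesgue. h x = 0"
proof (rule sigma_finite_measure.density_zero[OF sigma_finite_lebesgue int])
  have set_int: "integrable lebesgue (\<lambda>x. indicator A x *\<^sub>R h x)" if "A \<in> sets lebesgue" for A
    using integrable_mult_indicator[OF that int] .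
  have borel: "A \<in> sets lebesgue" if "A \<in> sets borel" for A :: "real set"
    using that by simp
  \<comment> \<open>The complement case of the induction needs the integral over the whole line. It
    is the limit of integrals over [-n, n].\<close>
  have whole: "(\<integral>x. h x \<partial>lebesgue) = 0"
  proof -
    have "(\<lambda>n. \<integral>x. indicator {-real n..real n} x *\<^sub>R h x \<partial>lebesgue) \<longlonglongrightarrow> (\<integral>x. h x \<partial>lebesgue)"
    proof (rule integral_dominated_convergence[where w="\<lambda>x. norm (h x)"])
      show "AE x in lebesgue. (\<lambda>n. indicat_real {-real n..real n} x *\<^sub>R h x) \<longlonglongrightarrow> h x"
      proof (rule AE_I2)
        fix x :: real
        obtain N where N: "\<bar>x\<bar> \<le> real N" using real_arch_simple by blast
        have "\<forall>\<^sub>F n in sequentially. indicat_real {-real n..real n} x *\<^sub>R h x = h x"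
          using eventually_ge_at_top[of N] by eventually_elim (use N in \<open>auto simp: indicator_def\<close>)
        then show "(\<lambda>n. indicat_real {-real n..real n} x *\<^sub>R h x) \<longlonglongrightarrow> h x"
          by (rule tendsto_eventually)
      qed
    next
      show "\<And>n. AE x in lebesgue. norm (indicat_real {-real n..real n} x *\<^sub>R h x) \<le> norm (h x)"
        by (auto simp: indicator_def)
    qed (use int in \<open>auto intro!: borel_measurable_integrable set_int\<close>)
    moreover have "(\<lambda>n. \<integral>x. indicator {-real n..real n} x *\<^sub>R h x \<partial>lebesgue) = (\<lambda>n. 0)"
      by (simp add: zero)
    ultimately show ?thesis by (simp add: LIMSEQ_const_iff)
  qed
  have borel_zero: "(\<integral>x. indicator A x *\<^sub>R h x \<partial>lebesgue) = 0" if "A \<in> sets borel" for A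
    using that
  proof (induction rule: borel_set_induct)
    case (compl A)
    have "(\<integral>x. indicator (-A) x *\<^sub>R h x \<partial>lebesgue)
        = (\<integral>x. h x - indicator A x *\<^sub>R h x \<partial>lebesgue)"
      by (intro Bochner_Integration.integral_cong) (auto simp: indicator_def)
    also have "\<dots> = 0"
      using compl int set_int[OF borel] whole by (subst Bochner_Integration.integral_diff) auto
    finally show ?case .
  next
    case (union f)
    have "set_lebesgue_integral lebesgue (\<Union>i. f i) h = (\<Sum>i. set_lebesgue_integral lebesgue (f i) h)"
    proof (rule lebesgue_integral_countable_add)
      show "set_integrable lebesgue (\<Union>i. f i) h"
        unfolding set_integrable_def by (rule set_int) (use union in auto)
    qed (use union in \<open>auto simp: disjoint_family_on_def\<close>)
    then show ?case using union.IH by (simp add: set_lebesgue_integral_def)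
  qed (auto simp: zero)
  show "set_lebesgue_integral lebesgue A h = 0" if AL: "A \<in> sets lebesgue" for A
  proof -
    obtain S N N' where A: "A = S \<union> N" "N \<subseteq> N'" "N' \<in> null_sets lborel" "S \<in> sets lborel"
      using sets_completionE[OF AL] by metis
    have "AE x in lebesgue. x \<notin> N'"
      using A(3) AE_completion AE_not_in by blast
    then have "AE x in lebesgue. indicat_real A x *\<^sub>R h x = indicator S x *\<^sub>R h x"
      by eventually_elim (use A in \<open>auto simp: indicator_def\<close>)
    then have "(\<integral>x. indicat_real A x *\<^sub>R h x \<partial>lebesgue) = (\<integral>x. indicator S x *\<^sub>R h x \<partial>lebesgue)"
      using A AL by (intro integral_cong_AE borel_measurable_integrable set_int) auto
    then show ?thesis using borel_zero A(4) by (simp add: set_lebesgue_integral_def)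
  qed
qed

section \<open>Integration of compactly supported functions\<close>

lemma test_function_deriv_support:
  assumes "compact K" "\<And>x. x \<notin> K \<Longrightarrow> \<phi> x = (0::real)" "x \<notin> K"
  shows "deriv \<phi> x = 0"
proof -
  have "open (- K)" using assms(1) by (simp add: compact_imp_closed open_Compl)
  then have "(\<phi> has_real_derivative 0) (at x)"
    using assms by (intro has_field_derivative_transform_within_open[of "\<lambda>_. 0" 0 x "- K" \<phi>]) auto
  then show ?thesis by (rule DERIV_imp_deriv)
qed


lemma integrable_compact_support:
  fixes f :: "real \<Rightarrow> 'b::euclidean_space"
  assumes "continuous_on UNIV f" "compact K" "\<And>x. x \<notin> K \<Longrightarrow> f x = 0"
  shows "integrable lebesgue f"
proof -
  obtain R where R: "K \<subseteq> {-R..R}"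
    using assms(2) compact_imp_bounded bounded_subset_cbox_symmetric[of K] by (auto simp: box_real)
  have "integrable (lebesgue_on {-R..R}) f"
    using assms(1) by (intro continuous_imp_integrable_real) (auto intro: continuous_on_subset)
  then have "integrable lebesgue (\<lambda>x. indicator {-R..R} x *\<^sub>R f x)"
    by (subst (asm) integrable_restrict_space) auto
  moreover have "indicator {-R..R} x *\<^sub>R f x = f x" for x
    using R assms(3)[of x] by (cases "x \<in> K") (auto simp: indicator_def)
  ultimately show ?thesis by simp
qed

lemma integral_derivative_compact_support:
  fixes F :: "real \<Rightarrow> 'b::euclidean_space"
  assumes der: "\<And>x. (F has_vector_derivative f x) (at x)" and cont: "continuous_on UNIV f"
    and K: "compact K" "\<And>x. x \<notin> K \<Longrightarrow> F x = 0" "\<And>x. x \<notin> K \<Longrightarrow> f x = 0"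
  shows "(\<integral>x. f x \<partial>lebesgue) = 0"
proof -
  obtain R where R: "K \<subseteq> {-R..R}"
    using K(1) compact_imp_bounded bounded_subset_cbox_symmetric[of K] by (auto simp: box_real)
  \<comment> \<open>The enlargement by 1 puts both endpoints strictly outside the support, so the
    boundary terms vanish.\<close>
  define S where "S = \<bar>R\<bar> + 1"
  have S: "K \<subseteq> {-S<..<S}" "0 < S" using R by (auto simp: S_def)
  have "(f has_integral F S - F (-S)) {-S..S}"
    using S(2) der by (intro fundamental_theorem_of_calculus) (auto intro: has_vector_derivative_at_within)
  moreover have "F S = 0" "F (-S) = 0" using S by (auto intro!: K(2))
  ultimately have "(f has_integral 0) {-S..S}" by simp
  then have "(f has_integral 0) UNIV"
  proof (rule has_integral_on_superset)
    show "f x = 0" if "x \<notin> {-S..S}" for x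
      using that S by (intro K(3)) auto
  qed simp
  moreover have "(f has_integral (\<integral>x. f x \<partial>lebesgue)) UNIV"
    using has_integral_integral_lebesgue[OF integrable_compact_support[OF cont K(1,3)]] .
  ultimately show ?thesis using has_integral_unique by blast
qed

text \<open>The product is dominated by the sum of the two squares, both of which are
  integrable.\<close>

lemma L2_times_compact_support_integrable:
  assumes f: "f \<in> L2 I" and I: "open I"
    and \<psi>: "continuous_on UNIV \<psi>" "compact K" "\<And>x. x \<notin> K \<Longrightarrow> \<psi> x = (0::real)"
  shows "integrable (lebesgue_on I) (\<lambda>x. \<psi> x *\<^sub>R f x)"
proof -
  have I': "I \<inter> space lebesgue \<in> sets lebesgue" "I \<in> sets lebesgue" using I by auto
  have "integrable lebesgue (\<lambda>x. (\<psi> x)\<^sup>2)"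
    using \<psi> by (intro integrable_compact_support[where K=K]) (auto intro!: continuous_intros)
  then have "integrable (lebesgue_on I) (\<lambda>x. (\<psi> x)\<^sup>2)"
    unfolding integrable_restrict_space[OF I'(1)] by (rule integrable_mult_indicator[OF I'(2)])
  moreover have "integrable (lebesgue_on I) (\<lambda>x. (cmod (f x))\<^sup>2)" using f by (simp add: L2_def)
  ultimately have "integrable (lebesgue_on I) (\<lambda>x. (\<psi> x)\<^sup>2 + (cmod (f x))\<^sup>2)" by simp
  moreover have "(\<lambda>x. \<psi> x *\<^sub>R f x) \<in> borel_measurable (lebesgue_on I)"
    using f I' continuous_imp_measurable_on_sets_lebesgue[OF continuous_on_subset[OF \<psi>(1)]]
    by (intro borel_measurable_scaleR) (auto simp: L2_def)
  moreover have "norm (\<psi> x *\<^sub>R f x) \<le> norm ((\<psi> x)\<^sup>2 + (cmod (f x))\<^sup>2)" for x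
  proof -
    have "2 * (\<bar>\<psi> x\<bar> * cmod (f x)) \<le> (\<psi> x)\<^sup>2 + (cmod (f x))\<^sup>2"
      using sum_squares_bound[of "\<bar>\<psi> x\<bar>" "cmod (f x)"] by (simp add: algebra_simps)
    then have "\<bar>\<psi> x\<bar> * cmod (f x) \<le> (\<psi> x)\<^sup>2 + (cmod (f x))\<^sup>2"
      using mult_nonneg_nonneg[OF abs_ge_zero[of "\<psi> x"] norm_ge_zero[of "f x"]] by linarith
    then show ?thesis by simp
  qed
  ultimately show ?thesis by (rule Bochner_Integration.integrable_bound[OF _ _ AE_I2])
qed

section \<open>Cutoff functions and the fundamental lemma of the calculus of variations\<close>

lemma has_real_derivative_pos_part_square:
  "((\<lambda>x::real. (max 0 x)\<^sup>2) has_real_derivative 2 * max 0 x) (at x)"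
proof (cases "x = 0")
  case True
  have "(\<lambda>h. (max 0 h)\<^sup>2 / h) \<midarrow>0\<rightarrow> (0::real)"
  proof (rule Lim_null_comparison)
    show "\<forall>\<^sub>F h in at 0. norm ((max 0 h)\<^sup>2 / h) \<le> \<bar>h::real\<bar>"
      by (rule always_eventually) (auto simp: max_def power2_eq_square)
    show "((\<lambda>h::real. \<bar>h\<bar>) \<longlongrightarrow> 0) (at 0)"
      by (auto intro!: tendsto_eq_intros)
  qed
  then show ?thesis using True by (simp add: DERIV_def)
next
  case False
  show ?thesis
  proof (cases "x > 0")
    case True
    have "((\<lambda>x. x\<^sup>2) has_real_derivative 2 * max 0 x) (at x)"
      using True by (auto intro!: derivative_eq_intros)
    then show ?thesis
      by (rule has_field_derivative_transform_within_open[where S="{0<..}"]) (use True in auto)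
  next
    assume "\<not> x > 0"
    with False have "x < 0" by simp
    have "((\<lambda>x. 0) has_real_derivative 2 * max 0 x) (at x)"
      using \<open>x < 0\<close> by simp
    then show ?thesis
      by (rule has_field_derivative_transform_within_open[where S="{..<0}"]) (use \<open>x < 0\<close> in auto)
  qed
qed

text \<open>As \<open>n \<rightarrow> \<infinity>\<close> these cutoffs increase to the indicator function of the open interval.\<close>

lemma interval_cutoff_test_function:
  fixes u v :: real
  assumes "{u..v} \<subseteq> I"
  defines "p \<equiv> \<lambda>x. (max 0 (x - u))\<^sup>2 * (max 0 (v - x))\<^sup>2"
  shows "(\<lambda>x. real n * p x / (1 + real n * p x)) \<in> test_functions I"
proof -
  define p' where "p' x = 2 * max 0 (x - u) * (max 0 (v - x))\<^sup>2
      - (max 0 (x - u))\<^sup>2 * (2 * max 0 (v - x))" for x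
  have d1: "((\<lambda>x. (max 0 (x - u))\<^sup>2) has_real_derivative 2 * max 0 (x - u)) (at x)" for x
    using DERIV_chain2[OF has_real_derivative_pos_part_square, of "\<lambda>x. x - u" 1 x UNIV]
    by (simp add: DERIV_diff[OF DERIV_ident DERIV_const, simplified])
  have d2: "((\<lambda>x. (max 0 (v - x))\<^sup>2) has_real_derivative - (2 * max 0 (v - x))) (at x)" for x
    using DERIV_chain2[OF has_real_derivative_pos_part_square, of "\<lambda>x. v - x" "-1" x UNIV]
    by (simp add: DERIV_diff[OF DERIV_const DERIV_ident, simplified])
  have p: "(p has_real_derivative p' x) (at x)" for x
    unfolding p_def p'_def by (rule DERIV_cong[OF DERIV_mult[OF d1 d2]]) (simp add: algebra_simps)
  have nonneg: "p x \<ge> 0" for x by (simp add: p_def)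
  have pos: "1 + real n * p x > 0" for x
    using nonneg[of x] by (simp add: add_pos_nonneg)
  then have ne: "1 + real n * p x \<noteq> 0" for x
    by (metis less_irrefl)
  \<comment> \<open>In the numerator of the quotient rule the terms containing
    \<open>p x * p' x\<close> cancel.\<close>
  have D: "((\<lambda>x. real n * p x / (1 + real n * p x)) has_real_derivative
      real n * p' x / (1 + real n * p x)\<^sup>2) (at x)" for x
    by (rule DERIV_cong[OF DERIV_divide[OF DERIV_cmult[OF p] DERIV_add[OF DERIV_const DERIV_cmult[OF p]] ne]])
      (simp add: power2_eq_square algebra_simps)
  have "deriv (\<lambda>x. real n * p x / (1 + real n * p x)) = (\<lambda>x. real n * p' x / (1 + real n * p x)\<^sup>2)"
    by (intro ext DERIV_imp_deriv D)
  moreover have "continuous_on UNIV (\<lambda>x. real n * p' x / (1 + real n * p x)\<^sup>2)"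
    using ne unfolding p_def p'_def by (intro continuous_intros) simp_all
  moreover have "(\<lambda>x. real n * p x / (1 + real n * p x)) differentiable at x" for x
    using D real_differentiable_def by blast
  moreover have "p x = 0" if "x \<notin> {u..v}" for x
    using that by (auto simp: p_def)
  then have "\<exists>K. compact K \<and> K \<subseteq> I \<and> (\<forall>x. x \<notin> K \<longrightarrow> real n * p x / (1 + real n * p x) = 0)"
    using assms(1) by (intro exI[of _ "{u..v}"]) simp
  ultimately show ?thesis unfolding test_functions_def by simp
qed

text \<open>Testing with the cutoffs and passing to the limit shows that \<open>f\<close> integrates
  to zero over every open interval whose closure lies in \<open>I\<close>. Hence \<open>f\<close>
  vanishes almost everywhere on each such interval, and countably many of them cover
  \<open>I\<close>.\<close>

theorem fundamental_lemma_calculus_of_variations: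
  assumes I: "open I" and f: "f \<in> L2 I"
    and zero: "\<And>\<phi>. \<phi> \<in> test_functions I \<Longrightarrow> (\<integral>x. \<phi> x *\<^sub>R f x \<partial>lebesgue_on I) = 0"
  shows "AE x in lebesgue_on I. f x = 0"
proof -
  have I': "I \<inter> space lebesgue \<in> sets lebesgue" "I \<in> sets lebesgue" using I by auto
  \<comment> \<open>Square integrability gives integrability on bounded intervals through |f| \<le>
    |f|^2 + 1.\<close>
  have loc: "integrable lebesgue (\<lambda>x. indicator {p<..<q} x *\<^sub>R f x)" if "{p..q} \<subseteq> I" for p q
  proof -
    have meas: "f \<in> borel_measurable (lebesgue_on I)" and sq: "integrable (lebesgue_on I) (\<lambda>x. (cmod (f x))\<^sup>2)"
      using f by (auto simp: L2_def)
    have "integrable lebesgue (\<lambda>x. indicator I x *\<^sub>R (cmod (f x))\<^sup>2)"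
      using sq by (simp add: integrable_restrict_space[OF I'(1)])
    moreover have "integrable lebesgue (indicat_real {p<..<q})"
      by (intro integrable_real_indicator) (auto simp: less_top[symmetric] emeasure_lborel_box_eq simp flip: box_real)
    ultimately have "integrable lebesgue (\<lambda>x. indicator I x *\<^sub>R (cmod (f x))\<^sup>2 + indicat_real {p<..<q} x)"
      by (rule Bochner_Integration.integrable_add)
    moreover have "(\<lambda>x. indicator I x *\<^sub>R f x) \<in> borel_measurable lebesgue"
      using meas borel_measurable_restrict_space_iff[OF I'(1), of f] by simp
    then have "(\<lambda>x. indicat_real {p<..<q} x *\<^sub>R (indicator I x *\<^sub>R f x)) \<in> borel_measurable lebesgue"
      by (rule borel_measurable_scaleR[rotated]) (simp add: borel_measurable_indicator)
    then have "(\<lambda>x. indicat_real {p<..<q} x *\<^sub>R f x) \<in> borel_measurable lebesgue"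
      by (rule measurable_cong[THEN iffD1, rotated]) (use that in \<open>auto simp: indicator_def\<close>)
    moreover have "norm (indicat_real {p<..<q} x *\<^sub>R f x)
        \<le> norm (indicator I x *\<^sub>R (cmod (f x))\<^sup>2 + indicat_real {p<..<q} x)" for x
    proof -
      have "2 * cmod (f x) \<le> (cmod (f x))\<^sup>2 + 1"
        using sum_squares_bound[of "cmod (f x)" 1] by simp
      then have "cmod (f x) \<le> (cmod (f x))\<^sup>2 + 1" using norm_ge_zero[of "f x"] by linarith
      moreover have "x \<in> I" if "x \<in> {p<..<q}"
        using that \<open>{p..q} \<subseteq> I\<close> by (meson greaterThanLessThan_subseteq_atLeastAtMost_iff order_refl subset_eq)
      ultimately show ?thesis by (auto simp: indicator_def)
    qed
    ultimately show ?thesis by (rule Bochner_Integration.integrable_bound[OF _ _ AE_I2])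
  qed
  have int0: "(\<integral>x. indicator {u<..<v} x *\<^sub>R f x \<partial>lebesgue) = 0" if "{u..v} \<subseteq> I" for u v
  proof -
    define p where "p x = (max 0 (x - u))\<^sup>2 * (max 0 (v - x))\<^sup>2" for x
    define \<phi> where "\<phi> n x = real n * p x / (1 + real n * p x)" for n x
    have test: "\<phi> n \<in> test_functions I" for n
      using interval_cutoff_test_function[OF that, of n] by (simp add: \<phi>_def[abs_def] p_def)
    have nonneg: "p x \<ge> 0" for x by (simp add: p_def)
    have out: "\<phi> n x = 0" if "x \<notin> {u<..<v}" for n x
      using that by (auto simp: \<phi>_def p_def)
    have bd: "0 \<le> \<phi> n x" "\<phi> n x \<le> 1" for n x
      using mult_nonneg_nonneg[OF of_nat_0_le_iff[of n] nonneg[of x]]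
      by (simp_all add: \<phi>_def)
    have cont: "continuous_on UNIV (\<phi> n)" for n
    proof -
      have "1 + real n * p x \<noteq> 0" for x
        using mult_nonneg_nonneg[OF of_nat_0_le_iff[of n] nonneg[of x]] by linarith
      then show ?thesis unfolding \<phi>_def[abs_def] p_def by (intro continuous_intros) auto
    qed
    have *: "(\<integral>x. \<phi> n x *\<^sub>R (indicator {u<..<v} x *\<^sub>R f x) \<partial>lebesgue) = 0" for n
    proof -
      have "(\<integral>x. \<phi> n x *\<^sub>R (indicator {u<..<v} x *\<^sub>R f x) \<partial>lebesgue)
          = (\<integral>x. indicator I x *\<^sub>R (\<phi> n x *\<^sub>R f x) \<partial>lebesgue)"
      proof (intro Bochner_Integration.integral_cong refl)
        fix x
        have "x \<in> I" if "x \<in> {u<..<v}"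
          using that \<open>{u..v} \<subseteq> I\<close> by (meson greaterThanLessThan_subseteq_atLeastAtMost_iff order_refl subset_eq)
        then show "\<phi> n x *\<^sub>R (indicator {u<..<v} x *\<^sub>R f x) = indicator I x *\<^sub>R (\<phi> n x *\<^sub>R f x)"
          using out[of x n] by (cases "x \<in> {u<..<v}") simp_all
      qed
      also have "\<dots> = (\<integral>x. \<phi> n x *\<^sub>R f x \<partial>lebesgue_on I)"
        by (rule integral_restrict_space[OF I'(1), symmetric])
      finally show ?thesis using zero[OF test] by simp
    qed
    have "(\<lambda>n. \<integral>x. \<phi> n x *\<^sub>R (indicator {u<..<v} x *\<^sub>R f x) \<partial>lebesgue)
        \<longlonglongrightarrow> (\<integral>x. indicator {u<..<v} x *\<^sub>R f x \<partial>lebesgue)"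
    proof (rule integral_dominated_convergence[where w="\<lambda>x. norm (indicat_real {u<..<v} x *\<^sub>R f x)"])
      show "(\<lambda>x. indicat_real {u<..<v} x *\<^sub>R f x) \<in> borel_measurable lebesgue"
        using loc[OF that] by (rule borel_measurable_integrable)
      then show "(\<lambda>x. \<phi> n x *\<^sub>R (indicat_real {u<..<v} x *\<^sub>R f x)) \<in> borel_measurable lebesgue" for n
        by (rule borel_measurable_scaleR[rotated])
          (use continuous_imp_measurable_on_sets_lebesgue[OF cont, of n] in \<open>simp add: lebesgue_on_UNIV_eq\<close>)
      show "integrable lebesgue (\<lambda>x. norm (indicat_real {u<..<v} x *\<^sub>R f x))"
        using loc[OF that] by (rule integrable_norm)
      show "AE x in lebesgue. norm (\<phi> n x *\<^sub>R (indicat_real {u<..<v} x *\<^sub>R f x))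
          \<le> norm (indicat_real {u<..<v} x *\<^sub>R f x)" for n
      proof (rule AE_I2)
        fix x
        show "norm (\<phi> n x *\<^sub>R (indicat_real {u<..<v} x *\<^sub>R f x)) \<le> norm (indicat_real {u<..<v} x *\<^sub>R f x)"
          using bd[of n x] mult_left_le_one_le[of "norm (indicat_real {u<..<v} x *\<^sub>R f x)" "\<phi> n x"] by simp
      qed
      show "AE x in lebesgue. (\<lambda>n. \<phi> n x *\<^sub>R (indicat_real {u<..<v} x *\<^sub>R f x))
          \<longlonglongrightarrow> indicat_real {u<..<v} x *\<^sub>R f x"
      proof (rule AE_I2)
        fix x :: real
        show "(\<lambda>n. \<phi> n x *\<^sub>R (indicat_real {u<..<v} x *\<^sub>R f x)) \<longlonglongrightarrow> indicat_real {u<..<v} x *\<^sub>R f x"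
        proof (cases "x \<in> {u<..<v}")
          case True
          have "p x > 0" using True by (auto simp: p_def)
          have "filterlim (\<lambda>n. 1 + p x * real n) at_top sequentially"
            by (intro filterlim_tendsto_add_at_top[OF tendsto_const]
                filterlim_tendsto_pos_mult_at_top[OF tendsto_const \<open>p x > 0\<close>] filterlim_real_sequentially)
          then have "(\<lambda>n. inverse (1 + p x * real n)) \<longlonglongrightarrow> 0"
            by (rule tendsto_inverse_0_at_top)
          from tendsto_diff[OF tendsto_const[of 1] this]
          have "(\<lambda>n. 1 - inverse (1 + p x * real n)) \<longlonglongrightarrow> 1" by simp
          \<comment> \<open>This form of the cutoff exhibits its limit 1 at points where
            \<open>p x > 0\<close>.\<close>
          moreover have "1 - inverse (1 + p x * real n) = \<phi> n x" for n
          proof -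
            have "1 + p x * real n > 0" using \<open>p x > 0\<close> by (simp add: add_pos_nonneg)
            then show ?thesis by (simp add: \<phi>_def field_simps)
          qed
          ultimately have "(\<lambda>n. \<phi> n x) \<longlonglongrightarrow> 1" by simp
          from tendsto_scaleR[OF this tendsto_const[of "f x"]] show ?thesis using True by simp
        qed simp
      qed
    qed
    then have "(\<lambda>n::nat. 0) \<longlonglongrightarrow> (\<integral>x. indicator {u<..<v} x *\<^sub>R f x \<partial>lebesgue)"
      by (simp only: *)
    then show ?thesis by (simp add: LIMSEQ_const_iff)
  qed
  have zero_on: "AE x in lebesgue. x \<in> {p<..<q} \<longrightarrow> f x = 0" if "{p..q} \<subseteq> I" for p q
  proof -
    have "AE x in lebesgue. indicat_real {p<..<q} x *\<^sub>R f x = 0"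
    proof (rule AE_zero_if_interval_integrals_zero[OF loc[OF that]])
      fix a b :: real
      \<comment> \<open>The closed interval cuts \<open>{p<..<q}\<close> in an open interval except
        possibly at \<open>a\<close> and \<open>b\<close>.\<close>
      have "AE x in lebesgue. x \<notin> {a,b}"
        by (intro AE_not_in null_sets_completionI finite_imp_null_set_lborel) simp
      then have "AE x in lebesgue. indicat_real {a..b} x *\<^sub>R (indicat_real {p<..<q} x *\<^sub>R f x)
          = indicat_real {max a p<..<min b q} x *\<^sub>R f x"
        by eventually_elim (auto simp: indicator_def)
      moreover have sub: "{max a p..min b q} \<subseteq> I" using that by auto
      moreover have "(\<lambda>x. indicat_real {a..b} x *\<^sub>R (indicat_real {p<..<q} x *\<^sub>R f x)) \<in> borel_measurable lebesgue"
        by (rule borel_measurable_integrable[OF integrable_mult_indicator[OF _ loc[OF that]]]) simp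
      ultimately have "(\<integral>x. indicat_real {a..b} x *\<^sub>R (indicat_real {p<..<q} x *\<^sub>R f x) \<partial>lebesgue)
          = (\<integral>x. indicat_real {max a p<..<min b q} x *\<^sub>R f x \<partial>lebesgue)"
        using borel_measurable_integrable[OF loc[OF sub]] by (intro integral_cong_AE) auto
      then show "(\<integral>x. indicat_real {a..b} x *\<^sub>R (indicat_real {p<..<q} x *\<^sub>R f x) \<partial>lebesgue) = 0"
        using int0[OF sub] by simp
    qed
    then show ?thesis by eventually_elim (auto simp: indicator_def)
  qed
  \<comment> \<open>Restricting to rational endpoints leaves countably many exceptional null sets,
    whose union is still null.\<close>
  have "AE x in lebesgue. \<forall>r\<in>\<rat>\<times>\<rat>. {fst r..snd r} \<subseteq> I \<longrightarrow> x \<in> {fst r<..<snd r} \<longrightarrow> f x = 0"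
    using zero_on by (subst AE_ball_countable) (auto simp: countable_rat)
  then have "AE x in lebesgue. x \<in> I \<longrightarrow> f x = 0"
  proof eventually_elim
    case (elim x)
    show ?case
    proof
      assume "x \<in> I"
      then obtain e where e: "e > 0" "cball x e \<subseteq> I" using I open_contains_cball by blast
      obtain p where p: "p \<in> \<rat>" "x - e < p" "p < x" using Rats_dense_in_real[of "x - e" x] e by auto
      obtain q where q: "q \<in> \<rat>" "x < q" "q < x + e" using Rats_dense_in_real[of x "x + e"] e by auto
      have "{p..q} \<subseteq> cball x e" using p q by (auto simp: dist_real_def)
      with e have "{p..q} \<subseteq> I" by blast
      then show "f x = 0" using elim p q by (auto dest!: bspec[of _ _ "(p,q)"])
    qed
  qed
  then show ?thesis by (simp add: AE_restrict_space_iff[OF I'(1)])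
qed

section \<open>Continuous representatives and their vertex values\<close>

lemma open_edge_dom: "open (edge_dom j)"
  by (cases j) auto

lemma open_not_AE_empty:
  assumes "open I" "x \<in> I" "AE x in lebesgue_on I. P x"
  shows "\<exists>x\<in>I. P x"
proof (rule ccontr)
  assume "\<not> ?thesis"
  moreover have "AE x in lebesgue. x \<in> I \<longrightarrow> P x"
    using assms(1,3) by (subst (asm) AE_restrict_space_iff) auto
  ultimately have "AE x in lebesgue. x \<in> I \<longrightarrow> x \<in> {}"
    by (auto elim!: eventually_mono)
  \<comment> \<open>If the property failed throughout \<open>I\<close>, almost every point of
    \<open>I\<close> would lie in the closed set {}, which then would contain all of
    \<open>I\<close>.\<close>
  then show False using mem_closed_if_AE_lebesgue_open[OF assms(1) closed_empty _ assms(2)] by blast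
qed

text \<open>Two different values at \<open>x\<close> can be separated by disjoint open sets, so by
  continuity the functions differ on a whole neighbourhood of \<open>x\<close>, which is not a null
  set.\<close>

lemma continuous_AE_eq_imp_eq:
  fixes f g :: "real \<Rightarrow> 'b::t2_space"
  assumes I: "open I" and f: "continuous_on I f" and g: "continuous_on I g"
    and ae: "AE x in lebesgue_on I. f x = g x" and x: "x \<in> I"
  shows "f x = g x"
proof (rule ccontr)
  assume ne: "f x \<noteq> g x"
  have lim: "(f \<longlongrightarrow> f x) (nhds x)" "(g \<longlongrightarrow> g x) (nhds x)"
    using f g I x by (simp_all add: continuous_on_eq_continuous_at isCont_def tendsto_at_iff_tendsto_nhds)
  obtain U V where UV: "open U" "open V" "f x \<in> U" "g x \<in> V" "U \<inter> V = {}"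
    using hausdorff[OF ne] by blast
  have "\<forall>\<^sub>F y in nhds x. f y \<in> U \<and> g y \<in> V \<and> y \<in> I"
    using topological_tendstoD[OF lim(1) UV(1,3)] topological_tendstoD[OF lim(2) UV(2,4)]
      eventually_nhds_in_open[OF I x] by eventually_elim simp
  then obtain W where W: "open W" "x \<in> W" "\<And>y. y \<in> W \<Longrightarrow> f y \<in> U \<and> g y \<in> V \<and> y \<in> I"
    unfolding eventually_nhds by blast
  have "AE y in lebesgue. y \<in> I \<longrightarrow> f y = g y"
    using I ae by (subst (asm) AE_restrict_space_iff) auto
  then have "AE y in lebesgue. y \<in> W \<longrightarrow> f y = g y"
    by eventually_elim (use W in auto)
  then have "AE y in lebesgue_on W. f y = g y"
    using W(1) by (subst AE_restrict_space_iff) auto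
  then obtain y where "y \<in> W" "f y = g y"
    using open_not_AE_empty[OF W(1,2)] by blast
  then show False using W(3)[of y] UV(5) by auto
qed

text \<open>Any other continuous representative agrees with \<open>w\<close> at every point of the
  edge and hence has the same limit at the vertex. This discharges the uniqueness demanded by
  \<open>THE\<close>.\<close>

lemma vertex_value_eq:
  assumes w: "continuous_on UNIV w" and ae: "AE x in lebesgue_on (edge_dom j). u x = w x"
  shows "vertex_value j u = w 0"
  unfolding vertex_value_def
proof (rule the_equality)
  have lim: "(w \<longlongrightarrow> w 0) (at 0 within edge_dom j)"
  proof -
    have "(w \<longlongrightarrow> w 0) (at 0)"
      using w by (simp add: continuous_on_eq_continuous_at isCont_def)
    then show ?thesis by (rule tendsto_within_subset) simp
  qed
  show "\<exists>v. continuous_on (edge_dom j) v \<and> (AE x in lebesgue_on (edge_dom j). u x = v x) \<and>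
      (v \<longlongrightarrow> w 0) (at 0 within edge_dom j)"
    by (intro exI[of _ w] conjI continuous_on_subset[OF w] ae lim) simp
  fix z
  assume "\<exists>v. continuous_on (edge_dom j) v \<and> (AE x in lebesgue_on (edge_dom j). u x = v x) \<and>
      (v \<longlongrightarrow> z) (at 0 within edge_dom j)"
  then obtain v where v: "continuous_on (edge_dom j) v" "AE x in lebesgue_on (edge_dom j). u x = v x"
      "(v \<longlongrightarrow> z) (at 0 within edge_dom j)" by blast
  have "AE x in lebesgue_on (edge_dom j). w x = v x"
    using ae v(2) by eventually_elim simp
  then have eq: "w x = v x" if "x \<in> edge_dom j" for x
    using continuous_AE_eq_imp_eq[OF open_edge_dom continuous_on_subset[OF w subset_UNIV] v(1) _ that] by simp
  have "(w \<longlongrightarrow> z) (at 0 within edge_dom j)"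
    using v(3) by (rule Lim_transform_within[where d=1]) (simp_all add: eq)
  \<comment> \<open>Limits are unique here because 0 is an accumulation point of each edge.\<close>
  moreover have "at (0::real) within edge_dom j \<noteq> bot"
    by (cases j) (auto simp: trivial_limit_at_left_real trivial_limit_at_right_real)
  ultimately show "z = w 0" using lim tendsto_unique by blast
qed

section \<open>Identification of weak derivatives\<close>

lemma L2_diff:
  assumes "f \<in> L2 I" "g \<in> L2 I"
  shows "(\<lambda>x. f x - g x) \<in> L2 I"
proof -
  have meas: "f \<in> borel_measurable (lebesgue_on I)" "g \<in> borel_measurable (lebesgue_on I)"
    and int: "integrable (lebesgue_on I) (\<lambda>x. 2 * (cmod (f x))\<^sup>2 + 2 * (cmod (g x))\<^sup>2)"
    using assms by (auto simp: L2_def)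
  have diff: "(\<lambda>x. f x - g x) \<in> borel_measurable (lebesgue_on I)"
    using meas by (rule borel_measurable_diff)
  have "(cmod (f x - g x))\<^sup>2 \<le> 2 * (cmod (f x))\<^sup>2 + 2 * (cmod (g x))\<^sup>2" for x
  proof -
    have "(cmod (f x - g x))\<^sup>2 \<le> (cmod (f x) + cmod (g x))\<^sup>2"
      by (intro power_mono norm_triangle_ineq4) simp
    also have "\<dots> \<le> 2 * (cmod (f x))\<^sup>2 + 2 * (cmod (g x))\<^sup>2"
      using sum_squares_bound[of "cmod (f x)" "cmod (g x)"] by (simp add: power2_sum)
    finally show ?thesis .
  qed
  then have "integrable (lebesgue_on I) (\<lambda>x. (cmod (f x - g x))\<^sup>2)"
    using diff by (intro Bochner_Integration.integrable_bound[OF int]) (auto intro!: AE_I2)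
  then show ?thesis using diff by (simp add: L2_def)
qed

lemma is_weak_deriv_cong_AE:
  assumes u: "u \<in> borel_measurable (lebesgue_on I)" "u' \<in> borel_measurable (lebesgue_on I)"
    and ae: "AE x in lebesgue_on I. u x = u' x" and I: "open I"
    and weak: "is_weak_deriv I u g"
  shows "is_weak_deriv I u' g"
  unfolding is_weak_deriv_def
proof
  fix \<phi> assume \<phi>: "\<phi> \<in> test_functions I"
  have "deriv \<phi> \<in> borel_measurable (lebesgue_on I)"
    using \<phi> I by (intro continuous_imp_measurable_on_sets_lebesgue)
      (auto simp: test_functions_def intro: continuous_on_subset)
  then have "(\<integral>x. deriv \<phi> x *\<^sub>R u' x \<partial>lebesgue_on I) = (\<integral>x. deriv \<phi> x *\<^sub>R u x \<partial>lebesgue_on I)"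
    using u ae by (intro integral_cong_AE borel_measurable_scaleR) (auto elim: eventually_mono)
  then show "(\<integral>x. deriv \<phi> x *\<^sub>R u' x \<partial>lebesgue_on I) = - (\<integral>x. \<phi> x *\<^sub>R g x \<partial>lebesgue_on I)"
    using weak \<phi> by (simp add: is_weak_deriv_def)
qed

lemma weak_deriv_unique:
  assumes I: "open I" and g: "g1 \<in> L2 I" "g2 \<in> L2 I"
    and weak: "is_weak_deriv I u g1" "is_weak_deriv I u g2"
  shows "AE x in lebesgue_on I. g1 x = g2 x"
proof -
  have "AE x in lebesgue_on I. g1 x - g2 x = 0"
  proof (rule fundamental_lemma_calculus_of_variations[OF I L2_diff[OF g]])
    fix \<phi> assume \<phi>: "\<phi> \<in> test_functions I"
    then obtain K where K: "compact K" "\<And>x. x \<notin> K \<Longrightarrow> \<phi> x = 0"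
      unfolding test_functions_def by blast
    have d: "\<phi> differentiable at x" for x using \<phi> by (simp add: test_functions_def)
    have cont: "continuous_on UNIV \<phi>"
      by (intro continuous_at_imp_continuous_on ballI differentiable_imp_continuous_within[OF d])
    \<comment> \<open>Both products must be integrable before the integral of the difference may be
      split.\<close>
    note int = L2_times_compact_support_integrable[OF _ I cont K]
    have "(\<integral>x. \<phi> x *\<^sub>R (g1 x - g2 x) \<partial>lebesgue_on I)
        = (\<integral>x. \<phi> x *\<^sub>R g1 x \<partial>lebesgue_on I) - (\<integral>x. \<phi> x *\<^sub>R g2 x \<partial>lebesgue_on I)"
      using int[OF g(1)] int[OF g(2)] by (simp add: scaleR_diff_right)
    also have "\<dots> = 0"
    proof -
      have "- (\<integral>x. \<phi> x *\<^sub>R g1 x \<partial>lebesgue_on I) = - (\<integral>x. \<phi> x *\<^sub>R g2 x \<partial>lebesgue_on I)"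
        using bspec[OF weak(1)[unfolded is_weak_deriv_def] \<phi>] bspec[OF weak(2)[unfolded is_weak_deriv_def] \<phi>]
        by simp
      then show ?thesis by simp
    qed
    finally show "(\<integral>x. \<phi> x *\<^sub>R (g1 x - g2 x) \<partial>lebesgue_on I) = 0" .
  qed
  then show ?thesis by simp
qed

text \<open>This is integration by parts: the derivative of \<open>\<phi> x *\<^sub>R f x\<close>
  integrates to zero because the product has compact support. Smoothness is asked on the whole line,
  so the computation needs no care at the boundary of \<open>I\<close>.\<close>

lemma is_weak_deriv_C1:
  assumes I: "open I" and der: "\<And>x. (f has_vector_derivative f' x) (at x)"
    and cont': "continuous_on UNIV f'"
  shows "is_weak_deriv I f f'"
  unfolding is_weak_deriv_def
proof
  fix \<phi> assume \<phi>: "\<phi> \<in> test_functions I"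
  then obtain K where K: "compact K" "K \<subseteq> I" "\<And>x. x \<notin> K \<Longrightarrow> \<phi> x = 0"
    unfolding test_functions_def by blast
  have cd: "continuous_on UNIV (deriv \<phi>)" and d: "\<phi> differentiable at x" for x
    using \<phi> by (simp_all add: test_functions_def)
  have I': "I \<inter> space lebesgue \<in> sets lebesgue" using I by auto
  have cont: "continuous_on UNIV f"
    by (intro continuous_at_imp_continuous_on ballI has_vector_derivative_continuous[OF der])
  have c\<phi>: "continuous_on UNIV \<phi>"
    by (intro continuous_at_imp_continuous_on ballI differentiable_imp_continuous_within[OF d])
  have d0: "deriv \<phi> x = 0" if "x \<notin> K" for x
    using test_function_deriv_support[OF K(1,3) that] .
  have D: "((\<lambda>x. \<phi> x *\<^sub>R f x) has_vector_derivative (\<phi> x *\<^sub>R f' x + deriv \<phi> x *\<^sub>R f x)) (at x)" for x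
    using d by (intro has_vector_derivative_scaleR der) (simp add: DERIV_deriv_iff_real_differentiable)
  have c1: "continuous_on UNIV (\<lambda>x. deriv \<phi> x *\<^sub>R f x)" and c2: "continuous_on UNIV (\<lambda>x. \<phi> x *\<^sub>R f' x)"
    using cont cont' c\<phi> cd by (auto intro!: continuous_intros)
  have "(\<integral>x. \<phi> x *\<^sub>R f' x + deriv \<phi> x *\<^sub>R f x \<partial>lebesgue) = 0"
    by (rule integral_derivative_compact_support[OF D _ K(1)])
      (simp_all add: K(3) d0 continuous_on_add[OF c2 c1])
  moreover have "integrable lebesgue (\<lambda>x. deriv \<phi> x *\<^sub>R f x)" "integrable lebesgue (\<lambda>x. \<phi> x *\<^sub>R f' x)"
    by (rule integrable_compact_support[OF c1 K(1)], simp add: d0,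
        rule integrable_compact_support[OF c2 K(1)], simp add: K(3))
  ultimately have "(\<integral>x. deriv \<phi> x *\<^sub>R f x \<partial>lebesgue) = - (\<integral>x. \<phi> x *\<^sub>R f' x \<partial>lebesgue)"
    by (simp add: add_eq_0_iff)
  \<comment> \<open>The supports of the test function and its derivative lie in \<open>I\<close>, so
    integrals over \<open>I\<close> and over the line coincide.\<close>
  moreover have "indicat_real I x *\<^sub>R (deriv \<phi> x *\<^sub>R f x) = deriv \<phi> x *\<^sub>R f x"
    "indicat_real I x *\<^sub>R (\<phi> x *\<^sub>R f' x) = \<phi> x *\<^sub>R f' x" for x
  proof -
    show "indicat_real I x *\<^sub>R (deriv \<phi> x *\<^sub>R f x) = deriv \<phi> x *\<^sub>R f x"
      using K(2) d0[of x] by (cases "x \<in> K") auto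
    show "indicat_real I x *\<^sub>R (\<phi> x *\<^sub>R f' x) = \<phi> x *\<^sub>R f' x"
      using K(2) K(3)[of x] by (cases "x \<in> K") auto
  qed
  ultimately show "(\<integral>x. deriv \<phi> x *\<^sub>R f x \<partial>lebesgue_on I) = - (\<integral>x. \<phi> x *\<^sub>R f' x \<partial>lebesgue_on I)"
    unfolding integral_restrict_space[OF I'] by presburger
qed

text \<open>The existence of \<open>f'\<close> makes the \<open>SOME\<close> choice meaningful, and
  uniqueness identifies the choice up to a null set. Allowing \<open>u\<close> to differ from
  \<open>f\<close> on a null set makes the lemma applicable again to a derivative that was itself
  chosen.\<close>

lemma weak_deriv_AE:
  assumes I: "open I" and L2: "u \<in> L2 I" "f \<in> L2 I" "f' \<in> L2 I"
    and ae: "AE x in lebesgue_on I. u x = f x" and weak: "is_weak_deriv I f f'"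
  shows "weak_deriv I u \<in> L2 I" "AE x in lebesgue_on I. weak_deriv I u x = f' x"
proof -
  have "AE x in lebesgue_on I. f x = u x" using ae by eventually_elim simp
  then have u: "is_weak_deriv I u f'"
    using L2 I weak by (intro is_weak_deriv_cong_AE[of f I u]) (auto simp: L2_def)
  then have *: "weak_deriv I u \<in> L2 I \<and> is_weak_deriv I u (weak_deriv I u)"
    unfolding weak_deriv_def
    using L2(3) someI[of "\<lambda>g. g \<in> L2 I \<and> is_weak_deriv I u g" f'] by simp
  then show "weak_deriv I u \<in> L2 I" by simp
  show "AE x in lebesgue_on I. weak_deriv I u x = f' x"
    by (rule weak_deriv_unique[OF I conjunct1[OF *] L2(3) conjunct2[OF *] u])
qed

section \<open>Exponentially decaying modes\<close>

text \<open>The substitution y = -s x maps the half-line onto (0, \<infinity>), where the integrand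
  becomes exp (-k y). The sign of \<open>s\<close> selects the half-line, so all edges are covered
  at once.\<close>

lemma integrable_exp_half_line:
  fixes s k :: real
  assumes "s \<noteq> 0" "0 < k"
  shows "integrable (lebesgue_on {x. s * x < 0}) (\<lambda>x. exp (k * (s * x)))"
proof -
  define g where "g y = indicat_real {0<..} y * exp (- k * y)" for y
  have "(\<lambda>y. exp (- k * y)) absolutely_integrable_on {0..}"
    using integrable_on_exp_minus_to_infinity[OF assms(2), of 0]
    by (intro nonnegative_absolutely_integrable_1) auto
  then have "(\<lambda>y. exp (- k * y)) absolutely_integrable_on {0<..}"
    by (rule set_integrable_subset) auto
  then have "integrable lebesgue g"
    by (simp add: set_integrable_def g_def[abs_def])
  moreover have "g \<in> borel_measurable borel"
    unfolding g_def[abs_def] by measurable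
  ultimately have "integrable lborel g"
    by (simp add: integrable_completion)
  from lborel_integrable_real_affine[OF this, of "- s" 0]
  have "integrable lborel (\<lambda>x. g (- s * x))" using assms by simp
  then have "integrable lebesgue (\<lambda>x. g (- s * x))"
    using borel_measurable_integrable by (subst integrable_completion) auto
  moreover have "g (- s * x) = indicat_real {x. s * x < 0} x *\<^sub>R exp (k * (s * x))" for x
    by (auto simp: g_def indicator_def)
  moreover have "{x. s * x < 0} \<inter> space lebesgue \<in> sets lebesgue"
    by (simp add: borel_open open_Collect_less continuous_intros)
  ultimately show ?thesis by (simp add: integrable_restrict_space)
qed

text \<open>
  All functions needed are of the form \<open>exp (k y) * p (tanh (y - b))\<close> with a polynomial \<open>p\<close>; this
  class is closed under differentiation because \<open>tanh' = 1 - tanh\<^sup>2\<close>.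
\<close>

definition mode :: "real \<Rightarrow> real \<Rightarrow> real \<Rightarrow> complex \<Rightarrow> real poly \<Rightarrow> real \<Rightarrow> complex" where
  "mode k s b \<alpha> p x = \<alpha> * of_real (exp (k * (s * x)) * poly p (tanh (s * x - b)))"

text \<open>The polynomial \<open>[:1, 0, -1:]\<close> is 1 - t^2, the derivative of tanh expressed
  in t = tanh. The outer factor \<open>s\<close> comes from the inner function s x.\<close>

definition mode_deriv :: "real \<Rightarrow> real \<Rightarrow> real poly \<Rightarrow> real poly" where
  "mode_deriv k s p = smult s (smult k p + pderiv p * [:1, 0, -1:])"

lemma has_vector_derivative_mode:
  "(mode k s b \<alpha> p has_vector_derivative mode k s b \<alpha> (mode_deriv k s p) x) (at x)"
proof -
  have c: "cosh y \<noteq> 0" for y :: real using cosh_real_pos[of y] by simp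
  have t: "((\<lambda>x. tanh (s * x - b)) has_real_derivative (1 - (tanh (s * x - b))\<^sup>2) * s) (at x)"
    by (rule DERIV_chain2[where f=tanh]) (auto intro!: derivative_eq_intros c)
  have e: "((\<lambda>x. exp (k * (s * x))) has_real_derivative exp (k * (s * x)) * (k * s)) (at x)"
    by (auto intro!: derivative_eq_intros)
  have "((\<lambda>x. exp (k * (s * x)) * poly p (tanh (s * x - b))) has_real_derivative
      exp (k * (s * x)) * poly (mode_deriv k s p) (tanh (s * x - b))) (at x)"
    by (rule DERIV_cong[OF DERIV_mult[OF e DERIV_chain2[OF poly_DERIV t]]])
      (simp add: mode_deriv_def algebra_simps power2_eq_square)
  then have "((\<lambda>x. of_real (exp (k * (s * x)) * poly p (tanh (s * x - b)))) has_vector_derivative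
      complex_of_real (exp (k * (s * x)) * poly (mode_deriv k s p) (tanh (s * x - b)))) (at x)"
    by (intro has_vector_derivative_of_real) 
  then show ?thesis unfolding mode_def[abs_def] by (rule has_vector_derivative_mult_right)
qed

lemma continuous_mode: "continuous_on UNIV (mode k s b \<alpha> p)"
  by (intro continuous_at_imp_continuous_on ballI has_vector_derivative_continuous[OF has_vector_derivative_mode])

text \<open>The values of tanh stay in [-1, 1], where \<open>p\<close> is bounded, so the mode is at
  most a constant times exp (k s x).\<close>

lemma mode_L2:
  assumes "s \<noteq> 0" "0 < k"
  shows "mode k s b \<alpha> p \<in> L2 {x. s * x < 0}"
proof -
  have op: "open {x. s * x < 0}" by (intro open_Collect_less continuous_intros)
  have "compact (poly p ` {-1..1})"
    by (intro compact_continuous_image continuous_intros) auto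
  then obtain B where "\<forall>y\<in>poly p ` {-1..1}. norm y \<le> B"
    using compact_imp_bounded bounded_iff by blast
  then have B: "\<bar>poly p t\<bar> \<le> B" if "t \<in> {-1..1}" for t
    using that by auto
  have meas: "mode k s b \<alpha> p \<in> borel_measurable (lebesgue_on {x. s * x < 0})"
    using op continuous_on_subset[OF continuous_mode]
    by (intro continuous_imp_measurable_on_sets_lebesgue) auto
  have "integrable (lebesgue_on {x. s * x < 0}) (\<lambda>x. (cmod \<alpha> * B)\<^sup>2 * exp ((2 * k) * (s * x)))"
    using assms by (intro integrable_mult_right integrable_exp_half_line) auto
  moreover have "(cmod (mode k s b \<alpha> p x))\<^sup>2 \<le> (cmod \<alpha> * B)\<^sup>2 * exp ((2 * k) * (s * x))" for x
  proof -
    have "\<bar>poly p (tanh (s * x - b))\<bar> \<le> B"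
      using tanh_real_lt_1[of "s * x - b"] tanh_real_gt_neg1[of "s * x - b"] by (intro B) auto
    then have "cmod \<alpha> * (exp (k * (s * x)) * \<bar>poly p (tanh (s * x - b))\<bar>)
        \<le> cmod \<alpha> * (exp (k * (s * x)) * B)"
      by (intro mult_left_mono) auto
    then have "cmod (mode k s b \<alpha> p x) \<le> cmod \<alpha> * B * exp (k * (s * x))"
      by (simp add: mode_def norm_mult abs_mult ac_simps)
    then have "(cmod (mode k s b \<alpha> p x))\<^sup>2 \<le> (cmod \<alpha> * B * exp (k * (s * x)))\<^sup>2"
      by (intro power_mono) auto
    also have "\<dots> = (cmod \<alpha> * B)\<^sup>2 * exp ((2 * k) * (s * x))"
      by (simp add: power_mult_distrib exp_double[symmetric] algebra_simps)
    finally show ?thesis .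
  qed
  ultimately have "integrable (lebesgue_on {x. s * x < 0}) (\<lambda>x. (cmod (mode k s b \<alpha> p x))\<^sup>2)"
    using meas by (elim Bochner_Integration.integrable_bound) auto
  then show ?thesis using meas by (simp add: L2_def)
qed

lemma eq_ae_Y_common:
  assumes "eq_ae_Y u z" "eq_ae_Y v z"
  shows "eq_ae_Y u v"
  unfolding eq_ae_Y_def
proof
  fix j
  have "AE x in lebesgue_on (edge_dom j). u j x = z j x" "AE x in lebesgue_on (edge_dom j). v j x = z j x"
    using assms by (simp_all add: eq_ae_Y_def)
  then show "AE x in lebesgue_on (edge_dom j). u j x = v j x" by eventually_elim simp
qed

lemma phase_eq_common: "phase_eq w z \<Longrightarrow> phase_eq w' z \<Longrightarrow> phase_eq w w'"
  unfolding phase_eq_def using eq_ae_Y_common by blast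

text \<open>
  In the variable \<open>y = slope c j * x\<close> every edge becomes the half-line \<open>y < 0\<close>, and the kink
  profile becomes \<open>4 * arctan (exp (y - b))\<close> with the same \<open>b = a E1 / c E1\<close> on all three edges.
\<close>

definition slope :: "(edge \<Rightarrow> real) \<Rightarrow> edge \<Rightarrow> real" where
  "slope c j = (if j = E1 then 1 else -1) / c j"

lemma edge_dom_slope:
  assumes "0 < c j"
  shows "edge_dom j = {x. slope c j * x < 0}"
  using assms by (cases j) (auto simp: slope_def divide_less_0_iff zero_less_divide_iff)

lemma slope_nz: "0 < c j \<Longrightarrow> slope c j \<noteq> 0"
  by (simp add: slope_def)

text \<open>The common amplitude \<open>\<alpha>\<close> makes one family provide the eigenfunction,
  its multiple in the velocity component, and the zero function.\<close>

definition graph_mode :: "(edge \<Rightarrow> real) \<Rightarrow> real \<Rightarrow> real \<Rightarrow> complex \<Rightarrow> graph_fun" where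
  "graph_mode c k b \<alpha> j = mode k (slope c j) b \<alpha> [:k, -1:]"

definition graph_mode_deriv :: "(edge \<Rightarrow> real) \<Rightarrow> real \<Rightarrow> real \<Rightarrow> complex \<Rightarrow> graph_fun" where
  "graph_mode_deriv c k b \<alpha> j = mode k (slope c j) b \<alpha> (mode_deriv k (slope c j) [:k, -1:])"

definition graph_mode_deriv2 :: "(edge \<Rightarrow> real) \<Rightarrow> real \<Rightarrow> real \<Rightarrow> complex \<Rightarrow> graph_fun" where
  "graph_mode_deriv2 c k b \<alpha> j =
     mode k (slope c j) b \<alpha> (mode_deriv k (slope c j) (mode_deriv k (slope c j) [:k, -1:]))"

section \<open>The modes on the graph and the eigenvalue equation\<close>

locale kink_modes =
  fixes c :: "edge \<Rightarrow> real" and k b :: real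
  assumes c_pos: "0 < c j" and k_pos: "0 < k"
begin

lemma mode_L2_edge: "mode k (slope c j) b \<alpha> p \<in> L2 (edge_dom j)"
  unfolding edge_dom_slope[of c j, OF c_pos] by (rule mode_L2[OF slope_nz[of c j, OF c_pos] k_pos])

lemma is_weak_deriv_mode:
  "is_weak_deriv (edge_dom j) (mode k s b \<alpha> p) (mode k s b \<alpha> (mode_deriv k s p))"
  by (rule is_weak_deriv_C1[OF open_edge_dom has_vector_derivative_mode continuous_mode])

lemma graph_mode_sobolev: "graph_mode c k b \<alpha> j \<in> sobolev (edge_dom j) (Suc (Suc 0))"
  using mode_L2_edge is_weak_deriv_mode unfolding graph_mode_def sobolev.simps by blast

lemma graph_mode_H2: "graph_mode c k b \<alpha> \<in> H_Y 2"
  using graph_mode_sobolev by (simp add: H_Y_def numeral_2_eq_2)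

lemma graph_mode_H1: "graph_mode c k b \<alpha> \<in> H_Y 1"
  using mode_L2_edge is_weak_deriv_mode unfolding graph_mode_def H_Y_def One_nat_def sobolev.simps by blast

lemma deriv_graph_mode:
  "deriv_Y (graph_mode c k b \<alpha>) j \<in> L2 (edge_dom j)"
  "AE x in lebesgue_on (edge_dom j). deriv_Y (graph_mode c k b \<alpha>) j x = graph_mode_deriv c k b \<alpha> j x"
proof -
  note weak = weak_deriv_AE[OF open_edge_dom mode_L2_edge mode_L2_edge mode_L2_edge AE_I2[OF refl] is_weak_deriv_mode]
  show "deriv_Y (graph_mode c k b \<alpha>) j \<in> L2 (edge_dom j)"
    unfolding deriv_Y_def graph_mode_def by (rule weak(1))
  show "AE x in lebesgue_on (edge_dom j). deriv_Y (graph_mode c k b \<alpha>) j x = graph_mode_deriv c k b \<alpha> j x"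
    unfolding deriv_Y_def graph_mode_def graph_mode_deriv_def by (rule weak(2))
qed

text \<open>The first weak derivative is known only up to a null set, so it is differentiated
  through its smooth representative.\<close>

lemma deriv2_graph_mode:
  "AE x in lebesgue_on (edge_dom j).
     deriv_Y (deriv_Y (graph_mode c k b \<alpha>)) j x = graph_mode_deriv2 c k b \<alpha> j x"
  unfolding deriv_Y_def[of "deriv_Y _"] graph_mode_deriv2_def
  by (rule weak_deriv_AE(2)[OF open_edge_dom deriv_graph_mode(1) mode_L2_edge mode_L2_edge
        deriv_graph_mode(2)[unfolded graph_mode_deriv_def] is_weak_deriv_mode])

lemma vertex_value_graph_mode:
  "vertex_value j (graph_mode c k b \<alpha> j) = \<alpha> * of_real (k - tanh (- b))"
  by (subst vertex_value_eq[OF continuous_mode[of k "slope c j" b \<alpha> "[:k, -1:]"]])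
    (simp_all add: graph_mode_def mode_def)

lemma vertex_value_deriv_graph_mode:
  "vertex_value j (deriv_Y (graph_mode c k b \<alpha>) j)
    = \<alpha> * of_real (slope c j * (k * (k - tanh (- b)) - (1 - (tanh (- b))\<^sup>2)))"
  by (subst vertex_value_eq[OF continuous_mode deriv_graph_mode(2)[unfolded graph_mode_deriv_def]])
    (simp add: mode_def mode_deriv_def power2_eq_square algebra_simps pderiv_pCons)

lemma graph_mode_continuous: "continuous_at_vertex (graph_mode c k b \<alpha>)"
  by (simp add: continuous_at_vertex_def vertex_value_graph_mode)

lemma graph_mode_energy_space: "graph_mode c k b \<alpha> \<in> energy_space"
  using graph_mode_H1 graph_mode_continuous by (simp add: energy_space_def)

text \<open>The slopes turn the weights \<open>(c j)\<^sup>2\<close> into \<open>c j\<close>, with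
  sign + on the incoming edge and - on the outgoing ones. After the subtraction of the
  \<open>E1\<close> term all three contributions are negative, so the flux condition reads -S D = Z
  (k - t), with S the sum of the \<open>c j\<close>, t = tanh (-b) and \<open>D\<close> as defined
  in the proof.\<close>

lemma graph_mode_dom_L:
  assumes "(\<Sum>j\<in>UNIV. c j) * (k * (k - tanh (- b)) - (1 - (tanh (- b))\<^sup>2)) + Z * (k - tanh (- b)) = 0"
  shows "graph_mode c k b \<alpha> \<in> dom_L c Z"
proof -
  define D where "D = k * (k - tanh (- b)) - (1 - (tanh (- b))\<^sup>2)"
  have cs: "(c j)\<^sup>2 * slope c j = (if j = E1 then 1 else -1) * c j" for j
    using c_pos[of j] by (simp add: slope_def power2_eq_square)
  have term_eq: "of_real ((c j)\<^sup>2) * vertex_value j (deriv_Y (graph_mode c k b \<alpha>) j)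
      = \<alpha> * of_real ((if j = E1 then 1 else -1) * c j * D)" for j
    unfolding vertex_value_deriv_graph_mode D_def[symmetric] cs[symmetric]
    by (simp add: algebra_simps)
  have "(c E1 + c E2 + c E3) * D + Z * (k - tanh (- b)) = 0"
    using assms by (simp add: D_def UNIV_edge add.assoc)
  then have "- (c E2 * D) - c E3 * D - c E1 * D = Z * (k - tanh (- b))"
    by (simp add: algebra_simps)
  then have "\<alpha> * of_real (- (c E2 * D) - c E3 * D - c E1 * D) = \<alpha> * of_real (Z * (k - tanh (- b)))"
    by simp
  then have "(\<Sum>j\<in>{E2, E3}. of_real ((c j)\<^sup>2) * vertex_value j (deriv_Y (graph_mode c k b \<alpha>) j))
      - of_real ((c E1)\<^sup>2) * vertex_value E1 (deriv_Y (graph_mode c k b \<alpha>) E1)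
      = of_real Z * vertex_value E1 (graph_mode c k b \<alpha> E1)"
    unfolding term_eq vertex_value_graph_mode by (simp add: algebra_simps)
  then show ?thesis using graph_mode_H2 graph_mode_continuous by (simp add: dom_L_def)
qed

text \<open>With T = tanh (s x - b), the second derivative of the mode is s^2 (k^2 - 2 (1 - T^2))
  times the mode. Since \<open>(c j)\<^sup>2 * (s * s) = 1\<close>, the T^2 terms cancel against the
  potential 2 T^2 - 1.\<close>

lemma graph_mode_ODE:
  "- of_real ((c j)\<^sup>2) * graph_mode_deriv2 c k b \<alpha> j x
    + of_real (2 * (tanh (slope c j * x - b))\<^sup>2 - 1) * graph_mode c k b \<alpha> j x
    = of_real (1 - k\<^sup>2) * graph_mode c k b \<alpha> j x"
proof -
  define s where "s = slope c j"
  define T where "T = tanh (s * x - b)"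
  define E where "E = exp (k * (s * x))"
  have cs: "(c j)\<^sup>2 * (s * s) = 1"
    using c_pos[of j] by (simp add: s_def slope_def power2_eq_square)
  have p2: "poly (mode_deriv k s (mode_deriv k s [:k, -1:])) T = s * s * ((k\<^sup>2 - 2 * (1 - T\<^sup>2)) * (k - T))"
    by (simp add: mode_deriv_def power2_eq_square algebra_simps pderiv_pCons pderiv_smult pderiv_add)
  have "- ((c j)\<^sup>2 * (E * (s * s * ((k\<^sup>2 - 2 * (1 - T\<^sup>2)) * (k - T))))) + (2 * T\<^sup>2 - 1) * (E * (k - T))
      = - ((c j)\<^sup>2 * (s * s)) * (E * ((k\<^sup>2 - 2 * (1 - T\<^sup>2)) * (k - T))) + (2 * T\<^sup>2 - 1) * (E * (k - T))"
    by (simp add: algebra_simps)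
  also have "\<dots> = (1 - k\<^sup>2) * (E * (k - T))"
    unfolding cs by (simp add: algebra_simps)
  finally have *: "- ((c j)\<^sup>2 * (E * poly (mode_deriv k s (mode_deriv k s [:k, -1:])) T)) + (2 * T\<^sup>2 - 1) * (E * poly [:k, -1:] T)
      = (1 - k\<^sup>2) * (E * poly [:k, -1:] T)"
    unfolding p2 by simp
  show ?thesis
    \<comment> \<open>The real identity is multiplied by the complex amplitude.\<close>
    using arg_cong[OF *, of "\<lambda>r. \<alpha> * of_real r"]
    unfolding graph_mode_def graph_mode_deriv2_def mode_def s_def[symmetric] T_def[symmetric] E_def[symmetric]
    by (simp only: of_real_add of_real_mult of_real_minus distrib_left mult.assoc mult_minus_left mult_minus_right)
      (simp only: mult.left_commute[of \<alpha>] mult.assoc)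
qed

text \<open>With velocity component \<mu> u the first component of the image vanishes identically.
  The second vanishes almost everywhere since L u = (1 - k^2) u = -\<mu>^2 u.\<close>

lemma JE_minus_graph_mode:
  assumes \<mu>: "\<mu>\<^sup>2 = k\<^sup>2 - 1"
    and cos: "\<And>j x. cos (\<phi> j x) = 2 * (tanh (slope c j * x - b))\<^sup>2 - 1"
  shows "phase_eq (JE_minus c \<phi> (of_real \<mu>) (graph_mode c k b \<alpha>, graph_mode c k b (of_real \<mu> * \<alpha>)))
    (\<lambda>_ _. 0, \<lambda>_ _. 0)"
proof -
  have scale: "graph_mode c k b (of_real \<mu> * \<alpha>) j x = of_real \<mu> * graph_mode c k b \<alpha> j x" for j x
    by (simp add: graph_mode_def mode_def)
  have "AE x in lebesgue_on (edge_dom j). - L_op c \<phi> (graph_mode c k b \<alpha>) j x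
      - of_real \<mu> * graph_mode c k b (of_real \<mu> * \<alpha>) j x = 0" for j
    using deriv2_graph_mode[of \<alpha> j]
  proof eventually_elim
    case (elim x)
    have "L_op c \<phi> (graph_mode c k b \<alpha>) j x = of_real (1 - k\<^sup>2) * graph_mode c k b \<alpha> j x"
      unfolding L_op_def elim cos by (rule graph_mode_ODE)
    also have "1 - k\<^sup>2 = - (\<mu> * \<mu>)" using \<mu> by (simp add: power2_eq_square)
    finally show ?case by (simp add: scale mult.assoc)
  qed
  then show ?thesis
    by (simp add: phase_eq_def eq_ae_Y_def JE_minus_def JE_def scale)
qed

text \<open>For k > 1 the factor k - tanh has no zero. One point of one edge where both modes agree
  already gives the contradiction.\<close>

lemma graph_mode_not_AE_zero:
  assumes "1 < k"
  shows "\<not> eq_ae_Y (graph_mode c k b 1) (graph_mode c k b 0)"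
proof
  assume "eq_ae_Y (graph_mode c k b 1) (graph_mode c k b 0)"
  then have "AE x in lebesgue_on {0<..}. graph_mode c k b 1 E2 x = graph_mode c k b 0 E2 x"
    unfolding eq_ae_Y_def by (metis edge_dom.simps(2))
  from open_not_AE_empty[OF open_greaterThan _ this, of 1]
  obtain x where "graph_mode c k b 1 E2 x = graph_mode c k b 0 E2 x" by auto
  then have "k = tanh (slope c E2 * x - b)"
    by (auto simp: graph_mode_def mode_def)
  then show False using assms tanh_real_lt_1[of "slope c E2 * x - b"] by simp
qed

end

section \<open>The kink profile and the eigenvalue condition\<close>

text \<open>The double-angle formula is applied twice, with cos (2 arctan (exp y)) = - tanh y in
  between.\<close>

lemma cos_4_arctan_exp: "cos (4 * arctan (exp y)) = 2 * (tanh y)\<^sup>2 - 1" for y :: real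
proof -
  define A where "A = arctan (exp y)"
  have "(cos A)\<^sup>2 = 1 / (1 + (exp y)\<^sup>2)"
    by (simp add: A_def cos_arctan power_divide real_sqrt_pow2 add_nonneg_nonneg)
  then have "cos (2 * A) = 2 * (1 / (1 + (exp y)\<^sup>2)) - 1"
    by (simp add: cos_double_cos)
  also have "\<dots> = - tanh y"
  proof -
    have "exp (- y) * (exp y * exp y) = exp y" by (simp flip: exp_add)
    moreover have "(exp y)\<^sup>2 > 0" "exp y + exp (-y) > 0" by (simp_all add: add_pos_pos)
    moreover have "exp y * exp (-y) = 1" by (simp flip: exp_add)
    ultimately show ?thesis
      by (simp add: tanh_altdef field_simps power2_eq_square add_pos_pos add_nonneg_eq_0_iff)
  qed
  finally have "cos (2 * (2 * A)) = 2 * (tanh y)\<^sup>2 - 1"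
    by (subst cos_double_cos) simp
  then show ?thesis by (simp add: A_def)
qed

section \<open>Existence of a root of the secular equation\<close>

lemma arctan_less_self:
  assumes "0 < x" shows "arctan x < x"
proof -
  have "\<exists>\<xi>>0. \<xi> < x \<and> arctan x - arctan 0 = (x - 0) * (1 / (1 + \<xi>\<^sup>2))"
    using assms by (intro MVT2) (auto intro!: derivative_eq_intros simp: field_simps)
  then obtain \<xi> where "\<xi> > 0" "arctan x = x / (1 + \<xi>\<^sup>2)" by auto
  moreover have "0 < 1 + \<xi>\<^sup>2" by (simp add: add_pos_nonneg)
  ultimately show ?thesis using assms by (simp add: divide_less_eq algebra_simps)
qed

text \<open>After multiplication by arctan s > 0 and insertion of the hypothesis, the claim becomes
  (1 - s^2) arctan s < s. For s < 1 it follows from arctan s < s; otherwise the left side is not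
  positive.\<close>

lemma profile_parameter_bound:
  fixes S Z s :: real
  assumes "0 < S" "0 < s"
    and "- (s / (1 + s\<^sup>2)) * S = Z * arctan s"
  shows "Z < S * ((s\<^sup>2 - 1) / (s\<^sup>2 + 1))"
proof -
  have A: "arctan s > 0" "arctan s < s" using assms(2) arctan_less_self by auto
  have pos: "1 + s\<^sup>2 > 0" by (simp add: add_pos_nonneg)
  have "(1 - s\<^sup>2) * arctan s < s"
  proof (cases "s < 1")
    case True
    have "(1 - s\<^sup>2) * arctan s \<le> 1 * arctan s" using A by (intro mult_right_mono) auto
    then show ?thesis using A(2) by linarith
  next
    case False
    then have "1 - s\<^sup>2 \<le> 0" using one_le_power[of s 2] by simp
    then have "(1 - s\<^sup>2) * arctan s \<le> 0" using A by (simp add: mult_nonpos_nonneg)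
    then show ?thesis using assms(2) by linarith
  qed
  then have "S * ((1 - s\<^sup>2) * arctan s) / (1 + s\<^sup>2) < S * s / (1 + s\<^sup>2)"
    using assms(1) pos by (intro divide_strict_right_mono mult_strict_left_mono)
  then have "- (S * s / (1 + s\<^sup>2)) < - (S * ((1 - s\<^sup>2) * arctan s) / (1 + s\<^sup>2))" by simp
  also have "- (S * ((1 - s\<^sup>2) * arctan s) / (1 + s\<^sup>2)) = S * ((s\<^sup>2 - 1) / (s\<^sup>2 + 1)) * arctan s"
    by (simp add: add.commute minus_divide_left algebra_simps)
  finally have "Z * arctan s < S * ((s\<^sup>2 - 1) / (s\<^sup>2 + 1)) * arctan s"
    unfolding assms(3)[symmetric] by (simp add: mult.commute)
  then show ?thesis by (rule mult_right_less_imp_less) (use A(1) in simp)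
qed

lemma tanh_of_exp: "tanh y = ((exp y)\<^sup>2 - 1) / ((exp y)\<^sup>2 + 1)" for y :: real
proof -
  have "tanh y = (exp y * (exp y - exp (- y))) / (exp y * (exp y + exp (- y)))"
    by (simp add: tanh_altdef)
  also have "exp y * (exp y - exp (- y)) = (exp y)\<^sup>2 - 1"
    by (simp add: algebra_simps power2_eq_square flip: exp_add)
  also have "exp y * (exp y + exp (- y)) = (exp y)\<^sup>2 + 1"
    by (simp add: algebra_simps power2_eq_square flip: exp_add)
  finally show ?thesis .
qed

lemma secular_equation_root:
  fixes S Z t :: real
  assumes "0 < S" "- S < Z" "Z < S * t" "\<bar>t\<bar> < 1"
  shows "\<exists>k>1. S * (k * (k - t) - (1 - t\<^sup>2)) + Z * (k - t) = 0"
proof -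
  define F where "F k = S * (k * (k - t) - (1 - t\<^sup>2)) + Z * (k - t)" for k
  have "F 1 = (1 - t) * (Z - S * t)" by (simp add: F_def algebra_simps power2_eq_square)
  then have F1: "F 1 < 0" using assms by (simp add: mult_pos_neg)
  have "F 3 = (3 - t) * (3 * S + Z) - S * (1 - t\<^sup>2)" by (simp add: F_def algebra_simps)
  \<comment> \<open>Here |t| < 1 gives 3 - t \<ge> 2, and Z > -S gives 3 S + Z \<ge> 2 S; the point
    3 is chosen large enough for these crude bounds.\<close>
  moreover have "2 * (2 * S) \<le> (3 - t) * (3 * S + Z)" using assms by (intro mult_mono) auto
  moreover have "S * (1 - t\<^sup>2) \<le> S * 1" using assms(1) by (intro mult_left_mono) auto
  ultimately have F3: "0 \<le> F 3" using assms(1) by linarith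
  have "continuous_on {1..3} F" unfolding F_def by (intro continuous_intros)
  from IVT'[of F 1 0 3, OF _ F3 _ this] F1
  obtain k where "1 \<le> k" "F k = 0" by auto
  \<comment> \<open>The strict sign at 1 excludes k = 1.\<close>
  then show ?thesis using F1 by (intro exI[of _ k]) (auto simp: F_def le_less)
qed

section \<open>The positive eigenvalue and the loss of injectivity\<close>

theorem theorem4p1:
  fixes c a :: "edge \<Rightarrow> real" and Z :: real
  assumes "\<And>j. 0 < c j"
    and "Z \<in> {- (\<Sum>j\<in>UNIV. c j) <..< 0}"
    and "- (exp (- a E1 / c E1) / (1 + exp (- 2 * a E1 / c E1))) * (\<Sum>j\<in>UNIV. c j)
           = Z * arctan (exp (- a E1 / c E1))"
    and "a E1 / c E1 = - (a E2 / c E2)"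
    and "a E1 / c E1 = - (a E3 / c E3)"
  shows "spectrally_unstable c Z (kink c a)"
proof -
  define b S s where "b = a E1 / c E1" and "S = (\<Sum>j\<in>UNIV. c j)" and "s = exp (- b)"
  have S: "0 < S" unfolding S_def using assms(1) by (intro sum_pos) auto
  have "exp (- 2 * a E1 / c E1) = s\<^sup>2"
    by (simp add: s_def b_def flip: exp_double)
  then have "- (s / (1 + s\<^sup>2)) * S = Z * arctan s"
    using assms(3) by (simp add: s_def b_def S_def)
  then have "Z < S * tanh (- b)"
    using profile_parameter_bound[of S s Z] S unfolding tanh_of_exp[of "- b"] s_def[symmetric]
    by (simp add: s_def)
  moreover have "\<bar>tanh (- b)\<bar> < 1"
    using tanh_real_lt_1[of "- b"] tanh_real_gt_neg1[of "- b"] by auto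
  ultimately obtain k where k: "1 < k"
      "S * (k * (k - tanh (- b)) - (1 - (tanh (- b))\<^sup>2)) + Z * (k - tanh (- b)) = 0"
    using secular_equation_root[of S Z "tanh (- b)"] S assms(2) unfolding S_def[symmetric] by auto
  interpret kink_modes c k b
    by unfold_locales (use assms(1) k(1) in auto)
  define \<mu> where "\<mu> = sqrt (k\<^sup>2 - 1)"
  have "k\<^sup>2 - 1 > 0" using k(1) by (simp add: one_less_power)
  then have \<mu>: "\<mu>\<^sup>2 = k\<^sup>2 - 1" "0 < \<mu>" by (simp_all add: \<mu>_def)
  \<comment> \<open>The relations between the shifts \<open>a j\<close> give the same
    \<open>b\<close> on all edges; the minus signs compensate the reversed orientation of
    \<open>E2\<close> and \<open>E3\<close>.\<close>
  have "kink c a j x = 4 * arctan (exp (slope c j * x - b))" for j x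
  proof (cases j)
    case E1
    then show ?thesis by (simp add: slope_def b_def diff_divide_distrib)
  next
    case E2
    have "b = - (a E2 / c E2)" using assms(4) by (simp add: b_def)
    then show ?thesis using E2 by (simp add: slope_def diff_divide_distrib)
  next
    case E3
    have "b = - (a E3 / c E3)" using assms(5) by (simp add: b_def)
    then show ?thesis using E3 by (simp add: slope_def diff_divide_distrib)
  qed
  then have cos: "cos (kink c a j x) = 2 * (tanh (slope c j * x - b))\<^sup>2 - 1" for j x
    by (simp add: cos_4_arctan_exp)
  \<comment> \<open>Injectivity in \<open>resolvent_JE\<close> compares two elements of the domain.
    The pair \<open>w 1\<close>, \<open>w 0\<close> violates it: both are sent to zero, but only
    \<open>w 0\<close> vanishes.\<close>
  define w where "w \<alpha> = (graph_mode c k b \<alpha>, graph_mode c k b (of_real \<mu> * \<alpha>))" for \<alpha>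
  have dom: "w \<alpha> \<in> dom_JE c Z" for \<alpha>
    using graph_mode_dom_L[OF k(2)[unfolded S_def]] graph_mode_energy_space
    by (simp add: w_def dom_JE_def)
  have zero: "phase_eq (JE_minus c (kink c a) (of_real \<mu>) (w \<alpha>)) (\<lambda>_ _. 0, \<lambda>_ _. 0)" for \<alpha>
    unfolding w_def by (rule JE_minus_graph_mode[OF \<mu>(1) cos])
  have "phase_eq (JE_minus c (kink c a) (of_real \<mu>) (w 1)) (JE_minus c (kink c a) (of_real \<mu>) (w 0))"
    by (rule phase_eq_common[OF zero zero])
  moreover have "\<not> phase_eq (w 1) (w 0)"
    using graph_mode_not_AE_zero[OF k(1)] by (simp add: phase_eq_def w_def)
  ultimately have "of_real \<mu> \<notin> resolvent_JE c Z (kink c a)"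
    using dom unfolding resolvent_JE_def by blast
  then have "of_real \<mu> \<in> spectrum_JE c Z (kink c a)"
    by (simp add: spectrum_JE_def)
  moreover have "Re (of_real \<mu>) \<noteq> 0" using \<mu>(2) by simp
  ultimately show ?thesis
    unfolding spectrally_unstable_def spectrally_stable_def by blast
qed

end
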